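(* Let $\alpha_1, A_1, A_2 > 0$ and consider the system of difference equations $$x_{n+1}=\frac{\alpha_{1}}{A_{1}+y_{n}},\qquad y_{n+1}=\frac{x_{n}}{A_{2}+x_{n}},\qquad n=0,1,2,\dots,$$ with arbitrary nonnegative initial conditions $x_0,y_0$. There is a unique nonnegative equilibrium $(\bar x,\bar y)$, given by $$\bar{x}=\frac{\alpha_{1}-A_{1}A_{2}+\sqrt{\left(\alpha_{1}-A_{1}A_{2}\right)^{2}+4\alpha_{1}A_{2}+4\alpha_{1}A_{1}A_{2}}}{2+2A_{1}},$$ $$\bar{y}=\frac{2\alpha_{1}+2A_{1}\alpha_{1}}{\alpha_{1}-A_{1}A_{2}+\sqrt{\left(\alpha_{1}-A_{1}A_{2}\right)^{2}+4\alpha_{1}A_{2}+4\alpha_{1}A_{1}A_{2}}}-A_{1},$$ and it is globally asymptotically stable.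
   Context: The state space is $[0,\infty)^2$. A nonnegative equilibrium is a point $(\bar x,\bar y)\in[0,\infty)^2$ such that the constant sequence $(x_n,y_n)=(\bar x,\bar y)$ solves the system. It is globally asymptotically stable if it is Lyapunov stable relative to $[0,\infty)^2$ (for every $\varepsilon>0$ there is $\delta>0$ such that every initial condition in $[0,\infty)^2$ within $\delta$ of $(\bar x,\bar y)$ has its whole orbit within $\varepsilon$ of $(\bar x,\bar y)$) and every solution with initial condition in $[0,\infty)^2$ converges to $(\bar x,\bar y)$. *)

theory Defs
  imports "HOL-Analysis.Analysis"
begin

definition solves :: "('a \<Rightarrow> 'a) \<Rightarrow> (nat \<Rightarrow> 'a) \<Rightarrow> bool" where
  "solves f z \<longleftrightarrow> (\<forall>n. z (Suc n) = f (z n))"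

definition equilibrium_in :: "'a set \<Rightarrow> ('a \<Rightarrow> 'a) \<Rightarrow> 'a \<Rightarrow> bool" where
  "equilibrium_in S f p \<longleftrightarrow> p \<in> S \<and> solves f (\<lambda>n. p)"

definition lyapunov_stable_in ::
  "'a::metric_space set \<Rightarrow> ('a \<Rightarrow> 'a) \<Rightarrow> 'a \<Rightarrow> bool" where
  "lyapunov_stable_in S f p \<longleftrightarrow>
     (\<forall>\<epsilon>>0. \<exists>\<delta>>0. \<forall>z. solves f z \<and> z 0 \<in> S \<and> dist (z 0) p < \<delta> \<longrightarrow>
        (\<forall>n. dist (z n) p < \<epsilon>))"

definition globally_attracting_in ::
  "'a::metric_space set \<Rightarrow> ('a \<Rightarrow> 'a) \<Rightarrow> 'a \<Rightarrow> bool" where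
  "globally_attracting_in S f p \<longleftrightarrow>
     (\<forall>z. solves f z \<and> z 0 \<in> S \<longrightarrow> z \<longlonglongrightarrow> p)"

definition globally_asymptotically_stable_in ::
  "'a::metric_space set \<Rightarrow> ('a \<Rightarrow> 'a) \<Rightarrow> 'a \<Rightarrow> bool" where
  "globally_asymptotically_stable_in S f p \<longleftrightarrow>
     lyapunov_stable_in S f p \<and> globally_attracting_in S f p"

abbreviation nonneg_quadrant :: "(real \<times> real) set" where
  "nonneg_quadrant \<equiv> {0..} \<times> {0..}"

text \<open>For positive parameters both denominators are positive on the nonnegative
  quadrant, and the quadrant is mapped into itself, so the convention
  \<open>t / 0 = 0\<close> never matters along a solution starting there.\<close>

definition rational_system :: "real \<Rightarrow> real \<Rightarrow> real \<Rightarrow> real \<times> real \<Rightarrow> real \<times> real" where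
  "rational_system \<alpha>\<^sub>1 A\<^sub>1 A\<^sub>2 = (\<lambda>(x, y). (\<alpha>\<^sub>1 / (A\<^sub>1 + y), x / (A\<^sub>2 + x)))"

end

theory Submission
  imports Defs
begin

text \<open>Eliminating \<open>y\<close> gives \<open>x\<^bsub>n+2\<^esub> = h x\<^bsub>n\<^esub>\<close> for a Moebius map \<open>h\<close> with two real fixed points,
  \<open>p > 0\<close> and \<open>- q < 0\<close>. The coordinate \<open>(x - p) / (x + q)\<close> conjugates \<open>h\<close> to multiplication by a
  constant of modulus less than 1. Since \<open>x\<^bsub>n\<^esub>\<close> is bounded for \<open>n \<ge> 1\<close>, this yields an exponential
  estimate for the distance to the equilibrium that is linear in the initial distance, hence both
  stability and attraction; attraction in turn forces the equilibrium to be unique.\<close>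

text \<open>One estimate serves both halves: the bound \<open>K\<close> on \<open>s\<close> makes
  \<epsilon> / \<open>K\<close> a valid \<delta>, and \<open>s\<close> tending to 0 gives
  attraction.\<close>

lemma globally_asymptotically_stable_inI:
  fixes p :: "'a::metric_space"
  assumes "\<And>n. s n \<le> K" "s \<longlonglongrightarrow> 0" "0 < K"
    and bound: "\<And>z n. solves f z \<Longrightarrow> z 0 \<in> S \<Longrightarrow> dist (z n) p \<le> s n * dist (z 0) p"
  shows "globally_asymptotically_stable_in S f p"
  unfolding globally_asymptotically_stable_in_def
proof
  show "lyapunov_stable_in S f p"
    unfolding lyapunov_stable_in_def
  proof (intro allI impI)
    fix \<epsilon> :: real assume "\<epsilon> > 0"
    show "\<exists>\<delta>>0. \<forall>z. solves f z \<and> z 0 \<in> S \<and> dist (z 0) p < \<delta> \<longrightarrow> (\<forall>n. dist (z n) p < \<epsilon>)"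
    proof (intro exI[of _ "\<epsilon> / K"] conjI allI impI)
      show "\<epsilon> / K > 0" using \<open>\<epsilon> > 0\<close> \<open>0 < K\<close> by simp
      fix z n assume z: "solves f z \<and> z 0 \<in> S \<and> dist (z 0) p < \<epsilon> / K"
      have "dist (z n) p \<le> s n * dist (z 0) p" using bound z by blast
      also have "\<dots> \<le> K * dist (z 0) p"
        using assms(1) by (intro mult_right_mono) auto
      also have "\<dots> < \<epsilon>" using z \<open>0 < K\<close> by (simp add: field_simps)
      finally show "dist (z n) p < \<epsilon>" .
    qed
  qed
  show "globally_attracting_in S f p"
    unfolding globally_attracting_in_def
  proof (intro allI impI)
    fix z assume z: "solves f z \<and> z 0 \<in> S"
    have lim: "(\<lambda>n. s n * dist (z 0) p) \<longlonglongrightarrow> 0"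
      using assms(2) by (rule tendsto_mult_left_zero)
    have "\<forall>\<^sub>F n in sequentially. norm (dist (z n) p) \<le> s n * dist (z 0) p"
      using bound z by simp
    then have "(\<lambda>n. dist (z n) p) \<longlonglongrightarrow> 0"
      using lim by (rule Lim_null_comparison)
    then show "z \<longlonglongrightarrow> p" by (rule iffD2[OF tendsto_dist_iff])
  qed
qed

text \<open>The constant sequence at \<open>q\<close> is a solution starting in \<open>S\<close>, so
  it must converge to \<open>p\<close>.\<close>

lemma globally_attracting_in_equilibrium_unique:
  assumes "globally_attracting_in S f p" "equilibrium_in S f q"
  shows "q = p"
proof -
  have "(\<lambda>n::nat. q) \<longlonglongrightarrow> p"
    using assms unfolding globally_attracting_in_def equilibrium_in_def by blast
  then show ?thesis by (simp add: LIMSEQ_const_iff)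
qed

text \<open>Here \<open>p\<close> and \<open>- q\<close> are roots of c t^2 + (d - a) t - b.
  Multiplied by \<open>c * x + d\<close>, both \<open>h - p\<close> and \<open>h + q\<close> become
  linear in \<open>x\<close>, vanishing at \<open>p\<close> and \<open>- q\<close> respectively; the
  quotient of their slopes is the multiplier.\<close>

lemma moebius_linearization:
  fixes a b c d p q x :: real
  assumes p: "p * (d + c * p) = a * p + b" and q: "c * p * q = b"
    and "0 < p" "0 < c * x + d"
  defines "h \<equiv> (a * x + b) / (c * x + d)"
  shows "(h - p) / (h + q) = (a - c * p) / (d + c * p) * ((x - p) / (x + q))"
proof -
  \<comment> \<open>Vieta for the sum of the roots: c (p - q) = a - d.\<close>
  have s: "a + c * q = d + c * p"
  proof -
    have "p * (a + c * q) = p * (d + c * p)" using p q by (simp add: algebra_simps)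
    then show ?thesis using \<open>0 < p\<close> by simp
  qed
  have h: "(c * x + d) * h = a * x + b"
    using \<open>0 < c * x + d\<close> by (simp add: h_def)
  have "(c * x + d) * (h - p) = (a - c * p) * (x - p)"
    using p unfolding right_diff_distrib h by (simp add: algebra_simps)
  moreover have "(c * x + d) * (h + q) = (d + c * p) * (x + q)"
  proof -
    have "(c * x + d) * (h + q) = (a * x + b) + (c * x + d) * q"
      by (simp add: distrib_left h)
    also have "\<dots> = (a + c * q) * x + b + d * q" by (simp add: algebra_simps)
    also have "\<dots> = (d + c * p) * (x + q)" unfolding s using q by (simp add: algebra_simps)
    finally show ?thesis .
  qed
  ultimately have "(c * x + d) * (h - p) / ((c * x + d) * (h + q))
      = (a - c * p) * (x - p) / ((d + c * p) * (x + q))" by simp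
  then show ?thesis using \<open>0 < c * x + d\<close> by simp
qed

lemma rational_system_globally_asymptotically_stable:
  fixes a A B p y :: real
  assumes pos: "0 < a" "0 < A" "0 < B" "0 < p"
    and eq: "p = a / (A + y)" "y = p / (B + p)"
  shows "globally_asymptotically_stable_in nonneg_quadrant (rational_system a A B) (p, y)"
proof -
  \<comment> \<open>Coefficients of the two-step map: a / (A + x / (B + x)) = (a x + b) / (c x + d).
    The choice of \<open>q\<close> makes \<open>- q\<close> its other fixed point.\<close>
  define c where "c = A + 1"
  define d where "d = A * B"
  define b where "b = a * B"
  define q where "q = b / (c * p)"
  define r where "r = \<bar>(a - c * p) / (d + c * p)\<bar>"
  \<comment> \<open>\<open>M\<close> will bound the first coordinate from time 1 on. The map t -> a
    / (A + t) has Lipschitz constant a / A^2 on t \<ge> 0; the extra 1 in \<open>L\<close> covers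
    time 0 as well. In \<open>K\<close>, passing to the linearizing coordinate costs 1 / q and
    passing back costs M + q.\<close>
  define M where "M = a / A"
  define L where "L = a / (A * A) + 1"
  define K where "K = (M + q) / q * L"
  have y: "0 < y" using eq(2) pos by simp
  have c: "0 < c" and d: "0 < d" and b: "0 < b" and M: "0 < M" and L: "1 \<le> L"
    using pos by (simp_all add: c_def d_def b_def M_def L_def)
  have q: "0 < q" "c * p * q = b" using b c pos by (simp_all add: q_def)
  have K: "0 \<le> K" using M L q by (simp add: K_def)
  have fix_p: "p * (d + c * p) = a * p + b"
  proof -
    have "p * (A + y) = a" using eq(1) y pos by (simp add: field_simps)
    then have "p * (A * (B + p) + y * (B + p)) = a * (B + p)"
      by (simp add: algebra_simps flip: \<open>p * (A + y) = a\<close>)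
    moreover have "y * (B + p) = p" using eq(2) pos by simp
    ultimately have "p * (A * (B + p) + p) = a * (B + p)" by simp
    then show ?thesis by (simp add: c_def d_def b_def algebra_simps)
  qed
  have dcp: "0 < d + c * p" using c d pos by (simp add: add_pos_pos)
  have r: "0 \<le> r" "r < 1"
  proof -
    \<comment> \<open>Positivity of \<open>b\<close> bounds \<open>a - c * p\<close> from above; the
      bound from below only uses that \<open>a\<close> and \<open>d\<close> are positive.\<close>
    have "a * p < p * (d + c * p)" using fix_p b by linarith
    then have "a < d + c * p" using pos by (simp add: mult.commute)
    moreover have "0 < c * p" using c pos by simp
    ultimately have "\<bar>a - c * p\<bar> < d + c * p" using d pos by linarith
    then show "r < 1" using dcp by (simp add: r_def)
  qed (simp add: r_def)
  \<comment> \<open>\<open>K\<close> accounts for the first coordinate and \<open>K / B\<close> for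
    the second, which lags one step behind; hence \<open>n - 1\<close>. At \<open>n = 0\<close>
    truncated subtraction gives exponent 0, and the summand 1 yields the estimate.\<close>
  define s where "s n = (K + K / B + 1) * r ^ ((n - 1) div 2)" for n
  have bound: "dist (z n) (p, y) \<le> s n * dist (z 0) (p, y)"
    if z: "solves (rational_system a A B) z" "z 0 \<in> nonneg_quadrant" for z n
  proof -
    define u where "u n = fst (z n)" for n
    define v where "v n = snd (z n)" for n
    define V where "V n = \<bar>(u n - p) / (u n + q)\<bar>" for n
    let ?D = "dist (z 0) (p, y)"
    have "z (Suc n) = rational_system a A B (u n, v n)" for n
      using z(1) by (simp add: solves_def u_def v_def)
    then have u_Suc: "u (Suc n) = a / (A + v n)" and v_Suc: "v (Suc n) = u n / (B + u n)" for n
      by (simp_all add: u_def v_def rational_system_def case_prod_beta)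
    have nonneg: "0 \<le> u n \<and> 0 \<le> v n" for n
    proof (induction n)
      case 0
      then show ?case using z(2) by (auto simp: u_def v_def mem_Times_iff)
    next
      case (Suc n)
      then show ?case using pos by (simp add: u_Suc v_Suc)
    qed
    have u_le: "u (Suc n) \<le> M" for n
      unfolding u_Suc M_def using nonneg[of n] pos by (intro divide_left_mono) auto
    have V_Suc_Suc: "V (Suc (Suc n)) = r * V n" for n
    proof -
      have "u (Suc (Suc n)) = (a * u n + b) / (c * u n + d)"
      proof -
        have "A + u n / (B + u n) = (c * u n + d) / (B + u n)"
          using nonneg[of n] pos by (simp add: c_def d_def field_simps)
        then show ?thesis by (simp add: u_Suc[of "Suc n"] v_Suc b_def algebra_simps)
      qed
      moreover have "0 < c * u n + d" using nonneg[of n] c d by (simp add: add_nonneg_pos)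
      ultimately show ?thesis
        using moebius_linearization[OF fix_p q(2) pos(4), of "u n"]
        by (simp only: V_def r_def abs_mult)
    qed
    have V_even_odd: "V (2 * m + i) = r ^ m * V i" for m i
      by (induction m) (simp_all add: V_Suc_Suc)
    have D: "\<bar>u 0 - p\<bar> \<le> ?D" "\<bar>v 0 - y\<bar> \<le> ?D"
      using dist_fst_le[of "z 0" "(p, y)"] dist_snd_le[of "z 0" "(p, y)"]
      by (simp_all add: u_def v_def dist_real_def)
    have V_le: "V n \<le> \<bar>u n - p\<bar> / q" for n
      using nonneg[of n] q(1) by (simp add: V_def abs_divide frac_le)
    have u_dist: "\<bar>u n - p\<bar> = V n * (u n + q)" for n
      using nonneg[of n] q(1) by (simp add: V_def abs_divide)
    have u1: "\<bar>u 1 - p\<bar> \<le> L * ?D"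
    proof -
      have "u 1 - p = a * (y - v 0) / ((A + v 0) * (A + y))"
        using nonneg[of 0] y pos by (simp add: u_Suc eq(1) field_simps)
      then have "\<bar>u 1 - p\<bar> = a * \<bar>v 0 - y\<bar> / ((A + v 0) * (A + y))"
        using nonneg[of 0] y pos by (simp add: abs_mult abs_divide abs_minus_commute)
      also have "\<dots> \<le> a * ?D / (A * A)"
        using nonneg[of 0] y pos D(2) by (intro frac_le mult_left_mono mult_mono) auto
      also have "\<dots> \<le> L * ?D" by (simp add: L_def distrib_right)
      finally show ?thesis .
    qed
    have u0: "\<bar>u 0 - p\<bar> \<le> L * ?D"
      using D(1) mult_right_mono[OF L, of ?D] by simp
    have u_bound: "\<bar>u n - p\<bar> \<le> K * r ^ (n div 2) * ?D" for n
    \<comment> \<open>The initial value \<open>u 0\<close> may exceed \<open>M\<close>, so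
      converting back from \<open>V\<close> with the factor \<open>M + q\<close> is possible only
      for positive \<open>n\<close>.\<close>
    proof (cases "n = 0")
      case True
      have "1 \<le> (M + q) / q" using M q by simp
      then have "L \<le> K" using mult_right_mono[of 1 "(M + q) / q" L] L by (simp add: K_def)
      then have "L * ?D \<le> K * ?D" by (intro mult_right_mono) auto
      then show ?thesis using True u0 by simp
    next
      case False
      have "\<bar>u (n mod 2) - p\<bar> \<le> L * ?D"
        using u0 u1 by (cases "even n") (simp_all add: odd_iff_mod_2_eq_one)
      then have V_init: "V (n mod 2) \<le> L * ?D / q"
        using V_le[of "n mod 2"] q(1) by (meson divide_right_mono less_imp_le order_trans)
      have "\<bar>u n - p\<bar> = V n * (u n + q)" by (rule u_dist)
      also have "\<dots> = r ^ (n div 2) * V (n mod 2) * (u n + q)"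
        using V_even_odd[of "n div 2" "n mod 2"] by simp
      also have "\<dots> \<le> r ^ (n div 2) * (L * ?D / q) * (M + q)"
        using V_init r(1) L q(1) nonneg[of n] u_le[of "n - 1"] False
        by (intro mult_mono mult_left_mono) auto
      also have "\<dots> = K * r ^ (n div 2) * ?D" by (simp add: K_def)
      finally show ?thesis .
    qed
    have v_bound: "\<bar>v (Suc n) - y\<bar> \<le> \<bar>u n - p\<bar> / B" for n
    proof -
      have "v (Suc n) - y = (u n - p) * (B / (B + p)) / (B + u n)"
        using nonneg[of n] pos by (simp add: v_Suc eq(2) field_simps)
      then have "\<bar>v (Suc n) - y\<bar> = \<bar>u n - p\<bar> * (B / (B + p)) / (B + u n)"
        using nonneg[of n] pos by (simp add: abs_mult abs_divide)
      also have "\<dots> \<le> \<bar>u n - p\<bar> * 1 / B"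
        using nonneg[of n] pos by (intro frac_le mult_left_mono) auto
      finally show ?thesis by simp
    qed
    have *: "dist (z n) (p, y) \<le> \<bar>u n - p\<bar> + \<bar>v n - y\<bar>"
      unfolding dist_prod_def dist_real_def u_def v_def
      using sqrt_sum_squares_le_sum_abs by simp
    show ?thesis
    proof (cases n)
      case 0
      have "0 \<le> (K + K / B) * ?D" using K pos by simp
      then show ?thesis by (simp add: 0 s_def distrib_right)
    next
      case (Suc m)
      have "\<bar>u n - p\<bar> \<le> K * r ^ (m div 2) * ?D"
      proof -
        \<comment> \<open>The exponent is lowered to the one available for the second coordinate, so
          that the two bounds can be added.\<close>
        have "r ^ (n div 2) \<le> r ^ (m div 2)"
          using r Suc by (intro power_decreasing) auto
        then have "K * r ^ (n div 2) * ?D \<le> K * r ^ (m div 2) * ?D"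
          using K by (intro mult_right_mono mult_left_mono) auto
        then show ?thesis using u_bound[of n] by linarith
      qed
      moreover have "\<bar>v n - y\<bar> \<le> K * r ^ (m div 2) * ?D / B"
        using v_bound[of m] divide_right_mono[OF u_bound[of m], of B] pos Suc by simp
      moreover have "0 \<le> r ^ (m div 2) * ?D" using r by simp
      ultimately show ?thesis using * Suc by (simp add: s_def algebra_simps)
    qed
  qed
  show ?thesis
  proof (rule globally_asymptotically_stable_inI[OF _ _ _ bound])
    have "0 \<le> K / B" using K pos by simp
    then show "s n \<le> K + K / B + 1" for n
      unfolding s_def using r K by (intro mult_left_le power_le_one) auto
    show "0 < K + K / B + 1" using K \<open>0 \<le> K / B\<close> by linarith
    have "filterlim (\<lambda>n::nat. (n - 1) div 2) sequentially sequentially"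
      unfolding filterlim_at_top
    proof
      fix Z :: nat
      show "\<forall>\<^sub>F n in sequentially. Z \<le> (n - 1) div 2"
        by (rule eventually_sequentiallyI[of "2 * Z + 1"]) auto
    qed
    from filterlim_compose[OF LIMSEQ_power_zero this, of r]
    show "s \<longlonglongrightarrow> 0"
      unfolding s_def using r by (intro tendsto_mult_right_zero) simp
  qed
qed

theorem theorem11:
  fixes \<alpha>\<^sub>1 A\<^sub>1 A\<^sub>2 :: real
  assumes "\<alpha>\<^sub>1 > 0" and "A\<^sub>1 > 0" and "A\<^sub>2 > 0"
  shows "let F = rational_system \<alpha>\<^sub>1 A\<^sub>1 A\<^sub>2;
             xbar = (\<alpha>\<^sub>1 - A\<^sub>1 * A\<^sub>2
                     + sqrt ((\<alpha>\<^sub>1 - A\<^sub>1 * A\<^sub>2)\<^sup>2 + 4 * \<alpha>\<^sub>1 * A\<^sub>2 + 4 * \<alpha>\<^sub>1 * A\<^sub>1 * A\<^sub>2))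
                    / (2 + 2 * A\<^sub>1);
             ybar = (2 * \<alpha>\<^sub>1 + 2 * A\<^sub>1 * \<alpha>\<^sub>1)
                    / (\<alpha>\<^sub>1 - A\<^sub>1 * A\<^sub>2
                       + sqrt ((\<alpha>\<^sub>1 - A\<^sub>1 * A\<^sub>2)\<^sup>2 + 4 * \<alpha>\<^sub>1 * A\<^sub>2 + 4 * \<alpha>\<^sub>1 * A\<^sub>1 * A\<^sub>2))
                    - A\<^sub>1
         in (\<exists>!p. equilibrium_in nonneg_quadrant F p) \<and>
            equilibrium_in nonneg_quadrant F (xbar, ybar) \<and>
            globally_asymptotically_stable_in nonneg_quadrant F (xbar, ybar)"
proof -
  define d where "d = \<alpha>\<^sub>1 - A\<^sub>1 * A\<^sub>2"
  define R where "R = sqrt (d\<^sup>2 + 4 * \<alpha>\<^sub>1 * A\<^sub>2 + 4 * \<alpha>\<^sub>1 * A\<^sub>1 * A\<^sub>2)"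
  define x where "x = (d + R) / (2 + 2 * A\<^sub>1)"
  define y where "y = (2 * \<alpha>\<^sub>1 + 2 * A\<^sub>1 * \<alpha>\<^sub>1) / (d + R) - A\<^sub>1"
  let ?F = "rational_system \<alpha>\<^sub>1 A\<^sub>1 A\<^sub>2"
  have R2: "R\<^sup>2 = d\<^sup>2 + 4 * \<alpha>\<^sub>1 * A\<^sub>2 + 4 * \<alpha>\<^sub>1 * A\<^sub>1 * A\<^sub>2"
    using assms by (simp add: R_def)
  \<comment> \<open>The left side is the absolute value of \<open>d\<close>, so \<open>d + R\<close>
    is positive whatever the sign of \<open>d\<close>.\<close>
  have "sqrt (d\<^sup>2) < R"
    unfolding R_def using assms by (intro real_sqrt_less_mono) (simp add: add_pos_pos)
  then have dR: "0 < d + R" by simp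
  have x: "0 < x" using dR assms by (simp add: x_def)
  \<comment> \<open>Substituting this into \<open>R2\<close> removes the root and leaves the
    quadratic for \<open>x\<close>, up to the factor \<open>4 * (1 + A\<^sub>1)\<close>.\<close>
  have R_x: "R = (2 + 2 * A\<^sub>1) * x - d" using assms by (simp add: x_def)
  have "4 * (1 + A\<^sub>1) * ((1 + A\<^sub>1) * x\<^sup>2) = 4 * (1 + A\<^sub>1) * (d * x + \<alpha>\<^sub>1 * A\<^sub>2)"
    using R2 unfolding R_x by (simp add: power2_eq_square algebra_simps)
  then have quad: "(1 + A\<^sub>1) * x\<^sup>2 = d * x + \<alpha>\<^sub>1 * A\<^sub>2"
    using assms by simp
  have y_x: "y = \<alpha>\<^sub>1 / x - A\<^sub>1"
    using dR assms by (simp add: x_def y_def field_simps)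
  have eq1: "x = \<alpha>\<^sub>1 / (A\<^sub>1 + y)" using assms x by (simp add: y_x)
  \<comment> \<open>With \<open>y\<close> expressed through \<open>x\<close>, clearing denominators
    turns this equation into \<open>quad\<close>.\<close>
  have eq2: "y = x / (A\<^sub>2 + x)"
    unfolding y_x using quad x assms by (simp add: d_def field_simps power2_eq_square)
  have "0 \<le> y" unfolding eq2 using x assms by simp
  then have E: "equilibrium_in nonneg_quadrant ?F (x, y)"
    using x
    by (simp add: equilibrium_in_def solves_def rational_system_def flip: eq1 eq2)
  have G: "globally_asymptotically_stable_in nonneg_quadrant ?F (x, y)"
    using assms x eq1 eq2 by (rule rational_system_globally_asymptotically_stable)
  then have attr: "globally_attracting_in nonneg_quadrant ?F (x, y)"
    unfolding globally_asymptotically_stable_in_def ..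
  have "\<exists>!p. equilibrium_in nonneg_quadrant ?F p"
  proof (rule ex1I)
    show "equilibrium_in nonneg_quadrant ?F (x, y)" by (fact E)
    fix p assume "equilibrium_in nonneg_quadrant ?F p"
    with attr show "p = (x, y)" by (rule globally_attracting_in_equilibrium_unique)
  qed
  from conjI[OF this conjI[OF E G]] show ?thesis
    unfolding Let_def x_def y_def R_def d_def .
qed

end
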